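(* Each equivalence class of the equivalence relation $E_{GH}$ on $\mathcal M$ is a Borel subset of $\mathcal M$.
   Context: $\mathcal M\subseteq\mathbb R^{\mathbb N\times\mathbb N}$ (product topology) is the closed set of distance matrices, i.e. $V=(v_{i,k})_{i,k}$ such that $(i,k)\mapsto v_{i,k}$ is a pseudo-metric on $\mathbb N$. For $V\in\mathcal M$, $M_V$ is the completion of the associated pseudo-metric space (after identifying points at distance $0$); this is a Polish metric space. The Gromov–Hausdorff distance $d_{GH}(X,Y)$ is the infimum of the Hausdorff distances between $i(X)$ and $j(Y)$ over all isometric embeddings $i:X\to Z$, $j:Y\to Z$ into a common metric space $Z$. Define $V\,E_{GH}\,W$ iff $d_{GH}(M_V,M_W)=0$. *)

theory Defs
  imports "HOL-Analysis.Analysis"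
begin

section \<open>Distance matrices\<close>

definition distance_matrices :: "(nat \<times> nat \<Rightarrow> real) set" where
  "distance_matrices =
     {V. (\<forall>i k. 0 \<le> V (i, k)) \<and> (\<forall>i. V (i, i) = 0) \<and> (\<forall>i k. V (i, k) = V (k, i)) \<and>
         (\<forall>i j k. V (i, k) \<le> V (i, j) + V (j, k))}"

section \<open>The metric quotient of a pseudo-metric on the natural numbers\<close>

definition null_rel :: "(nat \<times> nat \<Rightarrow> real) \<Rightarrow> (nat \<times> nat) set" where
  "null_rel V = {(i, k). V (i, k) = 0}"

definition quotient_metric :: "(nat \<times> nat \<Rightarrow> real) \<Rightarrow> nat set metric" where
  "quotient_metric V = metric (UNIV // null_rel V, \<lambda>A B. V (SOME i. i \<in> A, SOME k. k \<in> B))"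

lemma equiv_null_rel:
  assumes "V \<in> distance_matrices"
  shows "equiv UNIV (null_rel V)"
proof (rule equivI)
  show "null_rel V \<subseteq> UNIV \<times> UNIV" by simp
  show "refl (null_rel V)" using assms by (auto simp: null_rel_def distance_matrices_def refl_on_def)
  show "sym (null_rel V)" using assms by (auto simp: null_rel_def distance_matrices_def sym_def)
  show "trans (null_rel V)"
  proof (rule transI)
    fix i j k assume "(i, j) \<in> null_rel V" "(j, k) \<in> null_rel V"
    then have "V (i, j) = 0" "V (j, k) = 0" by (auto simp: null_rel_def)
    moreover have "0 \<le> V (i, k)" "V (i, k) \<le> V (i, j) + V (j, k)"
      using assms by (auto simp: distance_matrices_def)
    ultimately show "(i, k) \<in> null_rel V" by (simp add: null_rel_def)
  qed
qed

lemma null_rel_some: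
  assumes "V \<in> distance_matrices" "A \<in> UNIV // null_rel V"
  shows "(SOME i. i \<in> A) \<in> A" "null_rel V `` {SOME i. i \<in> A} = A"
proof -
  obtain x where A: "A = null_rel V `` {x}" using assms(2) by (rule quotientE)
  have "x \<in> A" unfolding A using equiv_null_rel[OF assms(1)] by (rule equiv_class_self) simp
  then show in_A: "(SOME i. i \<in> A) \<in> A" by (rule someI[of "\<lambda>i. i \<in> A"])
  show "null_rel V `` {SOME i. i \<in> A} = A"
  proof -
    have "(x, SOME i. i \<in> A) \<in> null_rel V" using in_A unfolding A by simp
    then have "null_rel V `` {x} = null_rel V `` {SOME i. i \<in> A}" by (rule equiv_class_eq[OF equiv_null_rel[OF assms(1)]])
    then show ?thesis unfolding A[symmetric] by simp
  qed
qed

lemma distance_matrix_cong: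
  assumes "V \<in> distance_matrices" "V (i, i') = 0" "V (k, k') = 0"
  shows "V (i, k) = V (i', k')"
proof -
  have tri: "\<And>a b c. V (a, c) \<le> V (a, b) + V (b, c)" and sym: "\<And>a b. V (a, b) = V (b, a)"
    using assms(1) by (simp_all add: distance_matrices_def)
  have "V (i, k) \<le> V (i', k')" using tri[of i k i'] tri[of i' k k'] sym[of k' k] assms by linarith
  moreover have "V (i', k') \<le> V (i, k)" using tri[of i' k' i] tri[of i k' k] sym[of i' i] assms by linarith
  ultimately show ?thesis by simp
qed

lemma Metric_space_quotient_metric:
  assumes "V \<in> distance_matrices"
  shows "Metric_space (UNIV // null_rel V) (\<lambda>A B. V (SOME i. i \<in> A, SOME k. k \<in> B))"
proof
  fix A B C :: "nat set"
  show "0 \<le> V (SOME i. i \<in> A, SOME k. k \<in> B)" using assms by (simp add: distance_matrices_def)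
  show "V (SOME i. i \<in> A, SOME k. k \<in> B) = V (SOME i. i \<in> B, SOME k. k \<in> A)"
    using assms by (simp add: distance_matrices_def)
  show "V (SOME i. i \<in> A, SOME k. k \<in> C)
      \<le> V (SOME i. i \<in> A, SOME k. k \<in> B) + V (SOME i. i \<in> B, SOME k. k \<in> C)"
    using assms by (simp add: distance_matrices_def)
  assume A: "A \<in> UNIV // null_rel V" and B: "B \<in> UNIV // null_rel V"
  have "(V (SOME i. i \<in> A, SOME k. k \<in> B) = 0)
      \<longleftrightarrow> (SOME i. i \<in> A, SOME k. k \<in> B) \<in> null_rel V"
    by (simp add: null_rel_def)
  also have "\<dots> \<longleftrightarrow> null_rel V `` {SOME i. i \<in> A} = null_rel V `` {SOME k. k \<in> B}"
    using eq_equiv_class_iff[OF equiv_null_rel[OF assms]] by simp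
  also have "\<dots> \<longleftrightarrow> A = B" using null_rel_some(2)[OF assms A] null_rel_some(2)[OF assms B] by simp
  finally show "V (SOME i. i \<in> A, SOME k. k \<in> B) = 0 \<longleftrightarrow> A = B" .
qed

lemma mspace_quotient_metric:
  "V \<in> distance_matrices \<Longrightarrow> mspace (quotient_metric V) = UNIV // null_rel V"
  unfolding quotient_metric_def by (simp add: Metric_space.mspace_metric[OF Metric_space_quotient_metric])

lemma mdist_quotient_metric:
  assumes V: "V \<in> distance_matrices"
  shows "mdist (quotient_metric V) (null_rel V `` {i}) (null_rel V `` {k}) = V (i, k)"
proof -
  have "V (i, SOME i'. i' \<in> null_rel V `` {i}) = 0" for i
    using null_rel_some(1)[OF V quotientI, of i] by (simp add: null_rel_def)
  from distance_matrix_cong[OF V this this] show ?thesis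
    unfolding quotient_metric_def
    by (simp add: Metric_space.mdist_metric[OF Metric_space_quotient_metric[OF V]])
qed

section \<open>Completion of a metric space\<close>

definition cauchy_seqs :: "'a metric \<Rightarrow> (nat \<Rightarrow> 'a) set" where
  "cauchy_seqs m = {\<sigma>. Metric_space.MCauchy (mspace m) (mdist m) \<sigma>}"

definition cauchy_rel :: "'a metric \<Rightarrow> ((nat \<Rightarrow> 'a) \<times> (nat \<Rightarrow> 'a)) set" where
  "cauchy_rel m = {(\<sigma>, \<tau>). \<sigma> \<in> cauchy_seqs m \<and> \<tau> \<in> cauchy_seqs m \<and>
                          (\<lambda>n. mdist m (\<sigma> n) (\<tau> n)) \<longlonglongrightarrow> 0}"

text \<open>The value outside the carrier is irrelevant, but the locale for metric spaces requires
  distances to be nonnegative everywhere.\<close>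

definition completion_dist :: "'a metric \<Rightarrow> (nat \<Rightarrow> 'a) set \<Rightarrow> (nat \<Rightarrow> 'a) set \<Rightarrow> real" where
  "completion_dist m A B =
     (if A \<in> cauchy_seqs m // cauchy_rel m \<and> B \<in> cauchy_seqs m // cauchy_rel m
      then lim (\<lambda>n. mdist m ((SOME \<sigma>. \<sigma> \<in> A) n) ((SOME \<tau>. \<tau> \<in> B) n)) else 0)"

definition completion :: "'a metric \<Rightarrow> (nat \<Rightarrow> 'a) set metric" where
  "completion m = metric (cauchy_seqs m // cauchy_rel m, completion_dist m)"

lemma mdist_self: "x \<in> mspace m \<Longrightarrow> mdist m x x = 0"
  by simp

lemma cauchy_seqs_mspace: "\<sigma> \<in> cauchy_seqs m \<Longrightarrow> \<sigma> n \<in> mspace m"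
  by (auto simp: cauchy_seqs_def Metric_space.MCauchy_def[OF Metric_space_mspace_mdist])

lemma cauchy_seqs_iff:
  "\<sigma> \<in> cauchy_seqs m \<longleftrightarrow> (\<forall>n. \<sigma> n \<in> mspace m) \<and>
     (\<forall>\<epsilon>>0. \<exists>N. \<forall>n n'. N \<le> n \<longrightarrow> N \<le> n' \<longrightarrow> mdist m (\<sigma> n) (\<sigma> n') < \<epsilon>)"
  by (auto simp: cauchy_seqs_def Metric_space.MCauchy_def[OF Metric_space_mspace_mdist])

lemma mdist_quad:
  assumes "a \<in> mspace m" "b \<in> mspace m" "c \<in> mspace m" "e \<in> mspace m"
  shows "\<bar>mdist m a b - mdist m c e\<bar> \<le> mdist m a c + mdist m b e"
  using mdist_triangle[of a m c b] mdist_triangle[of c m e b] mdist_triangle[of c m a e]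
    mdist_triangle[of a m b e] mdist_commute[of m a c] mdist_commute[of m b e] assms
  by linarith

lemma cauchy_seqs_convergent:
  assumes "\<sigma> \<in> cauchy_seqs m" "\<tau> \<in> cauchy_seqs m"
  shows "convergent (\<lambda>n. mdist m (\<sigma> n) (\<tau> n))"
proof (rule Cauchy_convergent, rule metric_CauchyI)
  fix e :: real assume "e > 0"
  then have e2: "e / 2 > 0" by simp
  obtain N1 where N1: "\<And>n n'. N1 \<le> n \<Longrightarrow> N1 \<le> n' \<Longrightarrow> mdist m (\<sigma> n) (\<sigma> n') < e / 2"
    using assms(1) e2 unfolding cauchy_seqs_iff by blast
  obtain N2 where N2: "\<And>n n'. N2 \<le> n \<Longrightarrow> N2 \<le> n' \<Longrightarrow> mdist m (\<tau> n) (\<tau> n') < e / 2"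
    using assms(2) e2 unfolding cauchy_seqs_iff by blast
  have "dist (mdist m (\<sigma> a) (\<tau> a)) (mdist m (\<sigma> b) (\<tau> b)) < e"
    if "max N1 N2 \<le> a" "max N1 N2 \<le> b" for a b
  proof -
    have "\<bar>mdist m (\<sigma> a) (\<tau> a) - mdist m (\<sigma> b) (\<tau> b)\<bar>
        \<le> mdist m (\<sigma> a) (\<sigma> b) + mdist m (\<tau> a) (\<tau> b)"
      by (intro mdist_quad cauchy_seqs_mspace assms)
    moreover have "mdist m (\<sigma> a) (\<sigma> b) < e / 2" using N1 that by simp
    moreover have "mdist m (\<tau> a) (\<tau> b) < e / 2" using N2 that by simp
    ultimately show ?thesis by (simp add: dist_real_def)
  qed
  then show "\<exists>M. \<forall>a\<ge>M. \<forall>b\<ge>M. dist (mdist m (\<sigma> a) (\<tau> a)) (mdist m (\<sigma> b) (\<tau> b)) < e"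
    by blast
qed

lemma equiv_cauchy_rel: "equiv (cauchy_seqs m) (cauchy_rel m)"
proof (rule equivI)
  show "cauchy_rel m \<subseteq> cauchy_seqs m \<times> cauchy_seqs m" by (auto simp: cauchy_rel_def)
  show "refl_on (cauchy_seqs m) (cauchy_rel m)"
    by (auto simp: cauchy_rel_def refl_on_def cauchy_seqs_mspace mdist_self)
  show "sym (cauchy_rel m)" by (auto simp: cauchy_rel_def sym_def mdist_commute)
  show "trans (cauchy_rel m)"
  proof (rule transI)
    fix \<rho> \<sigma> \<tau> assume a: "(\<rho>, \<sigma>) \<in> cauchy_rel m" "(\<sigma>, \<tau>) \<in> cauchy_rel m"
    then have in_c: "\<rho> \<in> cauchy_seqs m" "\<sigma> \<in> cauchy_seqs m" "\<tau> \<in> cauchy_seqs m"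
      by (auto simp: cauchy_rel_def)
    have "(\<lambda>n. mdist m (\<rho> n) (\<sigma> n) + mdist m (\<sigma> n) (\<tau> n)) \<longlonglongrightarrow> 0 + 0"
      using a by (intro tendsto_add) (auto simp: cauchy_rel_def)
    then have "(\<lambda>n. mdist m (\<rho> n) (\<tau> n)) \<longlonglongrightarrow> 0"
      by (rule_tac Lim_null_comparison[rotated])
        (auto intro!: always_eventually mdist_triangle cauchy_seqs_mspace in_c)
    with in_c show "(\<rho>, \<tau>) \<in> cauchy_rel m" by (simp add: cauchy_rel_def)
  qed
qed

lemma cauchy_class_some:
  assumes "A \<in> cauchy_seqs m // cauchy_rel m"
  shows "(SOME \<sigma>. \<sigma> \<in> A) \<in> cauchy_seqs m" "cauchy_rel m `` {SOME \<sigma>. \<sigma> \<in> A} = A"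
proof -
  obtain x where A: "A = cauchy_rel m `` {x}" "x \<in> cauchy_seqs m" using assms by (rule quotientE)
  have "x \<in> A" unfolding A using equiv_cauchy_rel A(2) by (rule equiv_class_self)
  then have in_A: "(SOME i. i \<in> A) \<in> A" by (rule someI[of "\<lambda>i. i \<in> A"])
  then show "(SOME \<sigma>. \<sigma> \<in> A) \<in> cauchy_seqs m" using A by (auto simp: cauchy_rel_def)
  show "cauchy_rel m `` {SOME i. i \<in> A} = A"
  proof -
    have "(x, SOME i. i \<in> A) \<in> cauchy_rel m" using in_A unfolding A(1) by simp
    then have "cauchy_rel m `` {x} = cauchy_rel m `` {SOME i. i \<in> A}" by (rule equiv_class_eq[OF equiv_cauchy_rel])
    then show ?thesis unfolding A(1)[symmetric] by simp
  qed
qed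

lemma completion_dist_class:
  assumes s: "\<sigma> \<in> cauchy_seqs m" and t: "\<tau> \<in> cauchy_seqs m"
  shows "(\<lambda>n. mdist m (\<sigma> n) (\<tau> n)) \<longlonglongrightarrow>
           completion_dist m (cauchy_rel m `` {\<sigma>}) (cauchy_rel m `` {\<tau>})"
proof -
  define A B where "A = cauchy_rel m `` {\<sigma>}" and "B = cauchy_rel m `` {\<tau>}"
  have AB: "A \<in> cauchy_seqs m // cauchy_rel m" "B \<in> cauchy_seqs m // cauchy_rel m"
    unfolding A_def B_def using s t by (auto intro: quotientI)
  define \<sigma>' \<tau>' where "\<sigma>' = (SOME \<sigma>. \<sigma> \<in> A)" and "\<tau>' = (SOME \<tau>. \<tau> \<in> B)"
  have c: "\<sigma>' \<in> cauchy_seqs m" "\<tau>' \<in> cauchy_seqs m"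
    unfolding \<sigma>'_def \<tau>'_def using AB by (auto intro: cauchy_class_some)
  have r: "(\<sigma>, \<sigma>') \<in> cauchy_rel m" "(\<tau>, \<tau>') \<in> cauchy_rel m"
    using cauchy_class_some(2)[OF AB(1)] cauchy_class_some(2)[OF AB(2)]
      eq_equiv_class_iff[OF equiv_cauchy_rel s c(1)] eq_equiv_class_iff[OF equiv_cauchy_rel t c(2)]
    unfolding \<sigma>'_def[symmetric] \<tau>'_def[symmetric] by (simp_all add: A_def B_def)
  have lim': "(\<lambda>n. mdist m (\<sigma>' n) (\<tau>' n)) \<longlonglongrightarrow> completion_dist m A B"
    using cauchy_seqs_convergent[OF c] AB
    by (simp add: completion_dist_def \<sigma>'_def \<tau>'_def convergent_LIMSEQ_iff)
  have "(\<lambda>n. mdist m (\<sigma> n) (\<sigma>' n) + mdist m (\<tau> n) (\<tau>' n)) \<longlonglongrightarrow> 0 + 0"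
    using r by (intro tendsto_add) (auto simp: cauchy_rel_def)
  then have "(\<lambda>n. mdist m (\<sigma> n) (\<tau> n) - mdist m (\<sigma>' n) (\<tau>' n)) \<longlonglongrightarrow> 0"
    by (rule_tac Lim_null_comparison[rotated])
      (auto intro!: always_eventually mdist_quad cauchy_seqs_mspace c s t)
  from tendsto_add[OF this lim'] show ?thesis by (simp add: A_def B_def)
qed

lemma Metric_space_completion:
  "Metric_space (cauchy_seqs m // cauchy_rel m) (completion_dist m)"
proof
  let ?Q = "cauchy_seqs m // cauchy_rel m"
  have nonneg: "0 \<le> completion_dist m A B" if AB: "A \<in> ?Q" "B \<in> ?Q" for A B
    using AB by (elim quotientE)
      (auto intro!: LIMSEQ_le_const[OF completion_dist_class])
  then show "0 \<le> completion_dist m A B" for A B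
    by (cases "A \<in> ?Q \<and> B \<in> ?Q") (auto simp: completion_dist_def)
  show "completion_dist m A B = completion_dist m B A" for A B
    by (auto simp: completion_dist_def mdist_commute)
  show "completion_dist m A B = 0 \<longleftrightarrow> A = B" if AB: "A \<in> ?Q" "B \<in> ?Q" for A B
  proof -
    obtain \<sigma> where s: "A = cauchy_rel m `` {\<sigma>}" "\<sigma> \<in> cauchy_seqs m" using AB(1) by (rule quotientE)
    obtain \<tau> where t: "B = cauchy_rel m `` {\<tau>}" "\<tau> \<in> cauchy_seqs m" using AB(2) by (rule quotientE)
    have "A = B \<longleftrightarrow> (\<lambda>n. mdist m (\<sigma> n) (\<tau> n)) \<longlonglongrightarrow> 0"
      using eq_equiv_class_iff[OF equiv_cauchy_rel s(2) t(2)] s t by (simp add: cauchy_rel_def)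
    then show ?thesis using completion_dist_class[OF s(2) t(2)] s t by (auto dest: LIMSEQ_unique)
  qed
  show "completion_dist m A C \<le> completion_dist m A B + completion_dist m B C"
    if ABC: "A \<in> ?Q" "B \<in> ?Q" "C \<in> ?Q" for A B C
  proof -
    obtain \<sigma> where s: "A = cauchy_rel m `` {\<sigma>}" "\<sigma> \<in> cauchy_seqs m" using ABC(1) by (rule quotientE)
    obtain \<tau> where t: "B = cauchy_rel m `` {\<tau>}" "\<tau> \<in> cauchy_seqs m" using ABC(2) by (rule quotientE)
    obtain \<rho> where r: "C = cauchy_rel m `` {\<rho>}" "\<rho> \<in> cauchy_seqs m" using ABC(3) by (rule quotientE)
    show ?thesis unfolding s(1) t(1) r(1)
      by (rule LIMSEQ_le[OF completion_dist_class[OF s(2) r(2)]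
            tendsto_add[OF completion_dist_class[OF s(2) t(2)] completion_dist_class[OF t(2) r(2)]]])
        (auto intro!: mdist_triangle cauchy_seqs_mspace s t r)
  qed
qed

lemma mspace_completion: "mspace (completion m) = cauchy_seqs m // cauchy_rel m"
  by (simp add: completion_def Metric_space.mspace_metric[OF Metric_space_completion])

lemma mdist_completion: "mdist (completion m) = completion_dist m"
  by (simp add: completion_def Metric_space.mdist_metric[OF Metric_space_completion])

definition completion_embed :: "'a metric \<Rightarrow> 'a \<Rightarrow> (nat \<Rightarrow> 'a) set" where
  "completion_embed m x = cauchy_rel m `` {\<lambda>n. x}"

lemma const_cauchy_seqs: "x \<in> mspace m \<Longrightarrow> (\<lambda>n. x) \<in> cauchy_seqs m"
  by (auto simp: cauchy_seqs_iff mdist_self)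

lemma completion_embed_mspace: "x \<in> mspace m \<Longrightarrow> completion_embed m x \<in> mspace (completion m)"
  by (simp add: completion_embed_def mspace_completion quotientI const_cauchy_seqs)

lemma completion_embed_isometric:
  assumes "x \<in> mspace m" "y \<in> mspace m"
  shows "mdist (completion m) (completion_embed m x) (completion_embed m y) = mdist m x y"
  using completion_dist_class[OF const_cauchy_seqs const_cauchy_seqs, OF assms]
  by (simp add: completion_embed_def mdist_completion LIMSEQ_const_iff)

lemma completion_embed_near:
  assumes s: "\<sigma> \<in> cauchy_seqs m" and e: "e > 0"
  shows "\<exists>N. \<forall>n\<ge>N. mdist (completion m) (completion_embed m (\<sigma> n)) (cauchy_rel m `` {\<sigma>}) \<le> e"
proof -
  obtain N where N: "\<And>n n'. N \<le> n \<Longrightarrow> N \<le> n' \<Longrightarrow> mdist m (\<sigma> n) (\<sigma> n') < e"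
    using assms unfolding cauchy_seqs_iff by blast
  have "mdist (completion m) (completion_embed m (\<sigma> n)) (cauchy_rel m `` {\<sigma>}) \<le> e"
    if "N \<le> n" for n
    unfolding completion_embed_def mdist_completion
    by (rule LIMSEQ_le_const2[OF completion_dist_class[OF const_cauchy_seqs[OF cauchy_seqs_mspace[OF s]] s]])
      (use N[OF that] in \<open>auto intro!: exI[of _ N] less_imp_le\<close>)
  then show ?thesis by blast
qed

lemma completion_embed_dense:
  assumes "A \<in> mspace (completion m)" "e > 0"
  shows "\<exists>x\<in>mspace m. mdist (completion m) (completion_embed m x) A \<le> e"
proof -
  obtain \<sigma> where s: "A = cauchy_rel m `` {\<sigma>}" "\<sigma> \<in> cauchy_seqs m"
    using assms(1) unfolding mspace_completion by (rule quotientE)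
  then show ?thesis using completion_embed_near[OF s(2) assms(2)] cauchy_seqs_mspace by blast
qed

lemma mcomplete_of_completion: "mcomplete_of (completion m)"
proof -
  let ?c = "completion m"
  interpret C: Metric_space "mspace ?c" "mdist ?c" by simp
  have "\<exists>A. limitin C.mtopology S A sequentially" if S: "C.MCauchy S" for S
  proof -
    have Sc: "S n \<in> mspace ?c" for n using S by (auto simp: C.MCauchy_def)
    have "\<forall>n. \<exists>x\<in>mspace m. mdist ?c (completion_embed m x) (S n) \<le> inverse (real (Suc n))"
      using completion_embed_dense[OF Sc] by simp
    then obtain x where x: "\<And>n. x n \<in> mspace m"
      and xS: "\<And>n. mdist ?c (completion_embed m (x n)) (S n) \<le> inverse (real (Suc n))"
      by metis
    have small: "\<exists>N. \<forall>n\<ge>N. inverse (real (Suc n)) < e" if "e > 0" for e :: real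
      using order_tendstoD(2)[OF LIMSEQ_inverse_real_of_nat that] by (simp add: eventually_sequentially)
    have "x \<in> cauchy_seqs m" unfolding cauchy_seqs_iff
    proof (intro conjI allI impI x)
      fix e :: real assume "e > 0"
      then have e3: "e / 3 > 0" by simp
      obtain N1 where N1: "\<And>n. n \<ge> N1 \<Longrightarrow> inverse (real (Suc n)) < e / 3" using small[OF e3] by blast
      obtain N2 where N2: "\<And>n n'. N2 \<le> n \<Longrightarrow> N2 \<le> n' \<Longrightarrow> mdist ?c (S n) (S n') < e / 3"
        using S e3 unfolding C.MCauchy_def by blast
      have "mdist m (x n) (x n') < e" if "max N1 N2 \<le> n" "max N1 N2 \<le> n'" for n n'
      proof -
        have "mdist m (x n) (x n') = mdist ?c (completion_embed m (x n)) (completion_embed m (x n'))"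
          using x by (simp add: completion_embed_isometric)
        also have "\<bar>\<dots> - mdist ?c (S n) (S n')\<bar> \<le> mdist ?c (completion_embed m (x n)) (S n)
            + mdist ?c (completion_embed m (x n')) (S n')"
          using x Sc by (intro mdist_quad completion_embed_mspace)
        finally show ?thesis
          using xS[of n] xS[of n'] N1[of n] N1[of n'] N2[of n n'] that by linarith
      qed
      then show "\<exists>N. \<forall>n n'. N \<le> n \<longrightarrow> N \<le> n' \<longrightarrow> mdist m (x n) (x n') < e" by blast
    qed
    define A where "A = cauchy_rel m `` {x}"
    have Ac: "A \<in> mspace ?c" using \<open>x \<in> cauchy_seqs m\<close>
      by (simp add: A_def mspace_completion quotientI)
    have "limitin C.mtopology S A sequentially"
    proof (subst C.limit_metric_sequentially, intro conjI allI impI Ac)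
      fix e :: real assume "e > 0"
      then have e2: "e / 2 > 0" by simp
      obtain N1 where N1: "\<And>n. n \<ge> N1 \<Longrightarrow> inverse (real (Suc n)) < e / 2" using small[OF e2] by blast
      obtain N2 where N2: "\<And>n. n \<ge> N2 \<Longrightarrow> mdist ?c (completion_embed m (x n)) A \<le> e / 2"
        using completion_embed_near[OF \<open>x \<in> cauchy_seqs m\<close> e2] unfolding A_def by blast
      have "S n \<in> mspace ?c \<and> mdist ?c (S n) A < e" if "max N1 N2 \<le> n" for n
        using mdist_triangle[OF Sc[of n] completion_embed_mspace[OF x[of n]] Ac] N1[of n] N2[of n]
          xS[of n] that Sc mdist_commute[of ?c "S n" "completion_embed m (x n)"] by auto
      then show "\<exists>N. \<forall>n\<ge>N. S n \<in> mspace ?c \<and> mdist ?c (S n) A < e" by blast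
    qed
    then show ?thesis by blast
  qed
  then show ?thesis by (simp add: mcomplete_of_def C.mcomplete_def)
qed

section \<open>Gromov--Hausdorff distance\<close>

definition hausdorff_dist :: "'c metric \<Rightarrow> 'c set \<Rightarrow> 'c set \<Rightarrow> ennreal" where
  "hausdorff_dist Z A B =
     max (SUP a\<in>A. INF b\<in>B. ennreal (mdist Z a b)) (SUP b\<in>B. INF a\<in>A. ennreal (mdist Z a b))"

definition isometric_embedding :: "'a metric \<Rightarrow> 'c metric \<Rightarrow> ('a \<Rightarrow> 'c) \<Rightarrow> bool" where
  "isometric_embedding X Z f \<longleftrightarrow>
     f \<in> mspace X \<rightarrow> mspace Z \<and>
     (\<forall>x\<in>mspace X. \<forall>y\<in>mspace X. mdist Z (f x) (f y) = mdist X x y)"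

text \<open>A quantifier cannot range over all types, so the ambient space \<open>Z\<close> is taken over the
  sum type. This is no restriction: one may shrink \<open>Z\<close> to the union of the two images, and
  \<open>gromov_hausdorff_dist_le\<close> below shows that ambient spaces over any other type do not
  lower the infimum.\<close>

definition gromov_hausdorff_dist :: "'a metric \<Rightarrow> 'b metric \<Rightarrow> ennreal" where
  "gromov_hausdorff_dist X Y =
     Inf {hausdorff_dist Z (i ` mspace X) (j ` mspace Y) | (Z :: ('a + 'b) metric) i j.
            isometric_embedding X Z i \<and> isometric_embedding Y Z j}"

lemma gromov_hausdorff_dist_le:
  fixes X :: "'a metric" and Y :: "'b metric" and Z :: "'c metric"
  assumes i: "isometric_embedding X Z i" and j: "isometric_embedding Y Z j"
  shows "gromov_hausdorff_dist X Y \<le> hausdorff_dist Z (i ` mspace X) (j ` mspace Y)"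
proof -
  define U where "U = i ` mspace X \<union> j ` mspace Y"
  define g :: "'c \<Rightarrow> 'a + 'b" where
    "g z = (if z \<in> i ` mspace X then Inl (inv_into (mspace X) i z) else Inr (inv_into (mspace Y) j z))" for z
  define h where "h = case_sum i j"
  have hg: "h (g z) = z" if "z \<in> U" for z
    using that by (auto simp: h_def g_def U_def f_inv_into_f)
  have US: "U \<subseteq> mspace Z" using i j by (auto simp: U_def isometric_embedding_def)
  have M: "Metric_space (g ` U) (\<lambda>p q. mdist Z (h p) (h q))"
  proof
    fix p q r assume "p \<in> g ` U" "q \<in> g ` U"
    then show "mdist Z (h p) (h q) = 0 \<longleftrightarrow> p = q" using hg US by (auto simp: subset_iff)
    assume "r \<in> g ` U"
    with \<open>p \<in> g ` U\<close> \<open>q \<in> g ` U\<close>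
    show "mdist Z (h p) (h r) \<le> mdist Z (h p) (h q) + mdist Z (h q) (h r)"
      using hg US by (auto intro!: mdist_triangle)
  qed (auto simp: mdist_commute)
  define Z' where "Z' = metric (g ` U, \<lambda>p q. mdist Z (h p) (h q))"
  have Z': "mspace Z' = g ` U" "mdist Z' = (\<lambda>p q. mdist Z (h p) (h q))"
    using M by (simp_all add: Z'_def Metric_space.mspace_metric Metric_space.mdist_metric)
  have "isometric_embedding X Z' (g \<circ> i)" "isometric_embedding Y Z' (g \<circ> j)"
    using i j hg by (auto simp: isometric_embedding_def Z' U_def)
  then have "gromov_hausdorff_dist X Y \<le> hausdorff_dist Z' ((g \<circ> i) ` mspace X) ((g \<circ> j) ` mspace Y)"
    unfolding gromov_hausdorff_dist_def by (intro Inf_lower) blast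
  also have "\<dots> = hausdorff_dist Z (i ` mspace X) (j ` mspace Y)"
    using hg by (simp add: hausdorff_dist_def Z' U_def image_image)
  finally show ?thesis .
qed

section \<open>The equivalence relation\<close>

definition coded_space :: "(nat \<times> nat \<Rightarrow> real) \<Rightarrow> (nat \<Rightarrow> nat set) set metric" where
  "coded_space V = completion (quotient_metric V)"

definition E_GH :: "((nat \<times> nat \<Rightarrow> real) \<times> (nat \<times> nat \<Rightarrow> real)) set" where
  "E_GH = {(V, W). V \<in> distance_matrices \<and> W \<in> distance_matrices \<and>
                   gromov_hausdorff_dist (coded_space V) (coded_space W) = 0}"

end

theory Submission
  imports Defs
begin

text \<open>
  Up to an arbitrarily small error, \<open>V\<close> and \<open>W\<close> are equivalent iff for each \<open>\<epsilon> > 0\<close> there is a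
  total and surjective relation on the indices with distortion at most \<open>\<epsilon>\<close>. Such a relation exists
  iff the second player wins a back-and-forth game whose positions are finite partial relations of
  distortion at most \<open>\<epsilon>\<close>. The argument is a metric version of Scott analysis. Countable transfinite
  iterates of the one-move operator are Borel conditions on \<open>W\<close>. As there are only countably many
  positions, one iterate \<open>S\<close> is already stable for the game of \<open>V\<close> against itself. If \<open>W\<close> is
  equivalent to \<open>V\<close>, composition with relations of small distortion transports this stability to
  the game of \<open>V\<close> against \<open>W\<close> at the cost of an arbitrarily small increase of \<open>\<epsilon>\<close>; conversely,
  stability in this weak sense is enough to win the game. So the class of \<open>V\<close> is defined by a
  countable conjunction of Borel conditions.
\<close>

section \<open>Relations of small distortion\<close>

definition total_surj :: "('a \<times> 'b) set \<Rightarrow> bool" where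
  "total_surj R \<longleftrightarrow> (\<forall>x. \<exists>y. (x, y) \<in> R) \<and> (\<forall>y. \<exists>x. (x, y) \<in> R)"

definition distortion_le ::
    "('a \<times> 'a \<Rightarrow> real) \<Rightarrow> ('b \<times> 'b \<Rightarrow> real) \<Rightarrow> ('a \<times> 'b) set \<Rightarrow> real \<Rightarrow> bool" where
  "distortion_le V W R e \<longleftrightarrow>
     (\<forall>p\<in>R. \<forall>q\<in>R. \<bar>V (fst p, fst q) - W (snd p, snd q)\<bar> \<le> e)"

text \<open>Rational tolerances make the quantifier over \<open>e\<close> countable and leave only
  countably many pairs of a tolerance and a position.\<close>

definition almost_isometric :: "('a \<times> 'a \<Rightarrow> real) \<Rightarrow> ('b \<times> 'b \<Rightarrow> real) \<Rightarrow> bool" where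
  "almost_isometric V W \<longleftrightarrow>
     (\<forall>e::rat. e > 0 \<longrightarrow> (\<exists>R. total_surj R \<and> distortion_le V W R (of_rat e)))"

lemma distortion_leD:
  "distortion_le V W R e \<Longrightarrow> (i, k) \<in> R \<Longrightarrow> (i', k') \<in> R \<Longrightarrow> \<bar>V (i, i') - W (k, k')\<bar> \<le> e"
  by (force simp: distortion_le_def)

lemma distortion_le_converse: "distortion_le W V (R\<inverse>) e \<longleftrightarrow> distortion_le V W R e"
  unfolding distortion_le_def by (force simp: abs_minus_commute)

lemma total_surj_converse: "total_surj (R\<inverse>) \<longleftrightarrow> total_surj R"
  by (auto simp: total_surj_def)

lemma distortion_le_subset: "distortion_le V W R e \<Longrightarrow> R' \<subseteq> R \<Longrightarrow> distortion_le V W R' e"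
  by (auto simp: distortion_le_def)

lemma distortion_le_mono: "distortion_le V W R e \<Longrightarrow> e \<le> e' \<Longrightarrow> distortion_le V W R e'"
  by (force simp: distortion_le_def)

section \<open>The back-and-forth game\<close>

text \<open>Both matrices are arguments, so that one iterate can be read at \<open>(V, V)\<close>
  and at \<open>(V, W)\<close>. Lists as positions form a countable type.\<close>

type_synonym game_relation =
  "(nat \<times> nat \<Rightarrow> real) \<Rightarrow> (nat \<times> nat \<Rightarrow> real) \<Rightarrow> rat \<Rightarrow> (nat \<times> nat) list \<Rightarrow> bool"

definition game_start :: game_relation where
  "game_start V W e p \<longleftrightarrow> distortion_le V W (set p) (of_rat e)"

definition game_step :: "game_relation \<Rightarrow> game_relation" where
  "game_step S V W e p \<longleftrightarrow>
     (\<forall>i. \<exists>k. S V W e ((i, k) # p)) \<and> (\<forall>k. \<exists>i. S V W e ((i, k) # p))"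

text \<open>These are the iterates of the step along countable ordinals; closing under countable
  intersections replaces the indexing by ordinals.\<close>

inductive game_iterate :: "game_relation \<Rightarrow> bool" where
  start: "game_iterate game_start"
| step: "game_iterate S \<Longrightarrow> game_iterate (game_step S)"
| inter: "(\<And>n::nat. game_iterate (F n)) \<Longrightarrow> game_iterate (\<lambda>V W e p. \<forall>n. F n V W e p)"

lemma game_iterate_le_start: "game_iterate S \<Longrightarrow> S V W e p \<Longrightarrow> game_start V W e p"
proof (induction arbitrary: p rule: game_iterate.induct)
  case (step S)
  then obtain k where "S V W e ((0, k) # p)" unfolding game_step_def by blast
  then have "game_start V W e ((0, k) # p)" by (rule step.IH)
  then show ?case by (auto simp: game_start_def elim: distortion_le_subset)
qed auto

text \<open>Coordinates are continuous, and every rule adds only quantifiers over countable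
  types.\<close>

lemma borel_game_iterate: "game_iterate S \<Longrightarrow> Measurable.pred borel (\<lambda>W. S V W e p)"
proof (induction arbitrary: p rule: game_iterate.induct)
  case start
  have [measurable]: "(\<lambda>W::nat \<times> nat \<Rightarrow> real. W x) \<in> borel_measurable borel" for x
    by (intro borel_measurable_continuous_onI continuous_on_product_coordinates)
  show ?case unfolding game_start_def distortion_le_def by measurable
next
  case (step S)
  note [measurable] = step.IH
  show ?case unfolding game_step_def by measurable
next
  case (inter F)
  note [measurable] = inter.IH
  show ?case by measurable
qed

text \<open>Distortions add under composition. Answers found in \<open>W\<close> are carried to
  \<open>U\<close> along \<open>R\<close>, and moves in \<open>U\<close> are pulled back to
  \<open>W\<close>; the \<open>list_all2\<close> condition keeps the two positions matched entry by
  entry.\<close>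

lemma game_iterate_compose:
  assumes "game_iterate S" "total_surj R" "distortion_le W U R (of_rat d)" "S V W e p"
    and "list_all2 (\<lambda>x y. fst x = fst y \<and> (snd x, snd y) \<in> R) p q"
  shows "S V U (e + d) q"
  using assms
proof (induction arbitrary: p q rule: game_iterate.induct)
  case start
  have lift: "\<exists>x\<in>set p. fst x = fst y \<and> (snd x, snd y) \<in> R" if "y \<in> set q" for y
    using start.prems(4) that by (induction rule: list_all2_induct) auto
  show ?case unfolding game_start_def distortion_le_def
  proof (intro ballI)
    fix y y' assume "y \<in> set q" "y' \<in> set q"
    then obtain x x' where x: "x \<in> set p" "fst x = fst y" "(snd x, snd y) \<in> R"
      and x': "x' \<in> set p" "fst x' = fst y'" "(snd x', snd y') \<in> R"
      using lift by blast
    have "\<bar>V (fst x, fst x') - W (snd x, snd x')\<bar> \<le> of_rat e"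
      using start.prems(3) x(1) x'(1) by (auto simp: game_start_def distortion_le_def)
    moreover have "\<bar>W (snd x, snd x') - U (snd y, snd y')\<bar> \<le> of_rat d"
      by (rule distortion_leD[OF start.prems(2) x(3) x'(3)])
    ultimately show "\<bar>V (fst y, fst y') - U (snd y, snd y')\<bar> \<le> of_rat (e + d)"
      unfolding x(2) x'(2) of_rat_add by linarith
  qed
next
  case (step S)
  have IH: "S V U (e + d) ((i, l) # q)" if "S V W e ((i, k) # p)" "(k, l) \<in> R" for i k l
    using step.IH[OF step.prems(1,2) that(1), of "(i, l) # q"] step.prems(4) that(2) by simp
  show ?case unfolding game_step_def
  proof (intro conjI allI)
    fix i
    obtain k where "S V W e ((i, k) # p)" using step.prems(3) by (auto simp: game_step_def)
    moreover obtain l where "(k, l) \<in> R" using step.prems(1) by (auto simp: total_surj_def)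
    ultimately show "\<exists>l. S V U (e + d) ((i, l) # q)" using IH by blast
  next
    fix l
    obtain k where "(k, l) \<in> R" using step.prems(1) by (auto simp: total_surj_def)
    moreover obtain i where "S V W e ((i, k) # p)" using step.prems(3) by (auto simp: game_step_def)
    ultimately show "\<exists>i. S V U (e + d) ((i, l) # q)" using IH by blast
  qed
next
  case (inter F)
  then show ?case by blast
qed

text \<open>The second player always answers with a partner in \<open>R\<close>, so the position
  never leaves \<open>R\<close>.\<close>

lemma game_iterate_of_total_surj:
  assumes "game_iterate S" "total_surj R" "distortion_le V W R (of_rat e)" "set p \<subseteq> R"
  shows "S V W e p"
  using assms
proof (induction arbitrary: p rule: game_iterate.induct)
  case start
  then show ?case by (auto simp: game_start_def intro: distortion_le_subset)
next
  case (step S)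
  show ?case unfolding game_step_def
  proof (intro conjI allI)
    fix i
    obtain k where "(i, k) \<in> R" using step.prems(1) by (auto simp: total_surj_def)
    with step show "\<exists>k. S V W e ((i, k) # p)" by (intro exI[of _ k]) simp
  next
    fix k
    obtain i where "(i, k) \<in> R" using step.prems(1) by (auto simp: total_surj_def)
    with step show "\<exists>i. S V W e ((i, k) # p)" by (intro exI[of _ i]) simp
  qed
qed blast

section \<open>A stable iterate and its transfer from \<open>(V, V)\<close> to
  \<open>(V, W)\<close>\<close>

text \<open>Countability takes the place of a closure ordinal: intersecting one failing iterate for
  each pair that some iterate rejects leaves only pairs accepted by all iterates,
  \<open>game_step S\<close> among them.\<close>

lemma game_iterate_stable:
  "\<exists>S. game_iterate S \<and> (\<forall>e p. S V V e p \<longrightarrow> game_step S V V e p)"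
proof -
  \<comment> \<open>An iterate that fails at \<open>x\<close> is wanted; if there is none,
    \<open>game_start\<close> will do, as all iterates then hold at \<open>x\<close>.\<close>
  have "\<exists>S. game_iterate S \<and> (S V V (fst x) (snd x) \<longrightarrow> (\<forall>S'. game_iterate S' \<longrightarrow> S' V V (fst x) (snd x)))"
    for x
    using game_iterate.start by blast
  then obtain G where G: "\<And>x. game_iterate (G x)"
    and least: "\<And>x S'. G x V V (fst x) (snd x) \<Longrightarrow> game_iterate S' \<Longrightarrow> S' V V (fst x) (snd x)"
    by metis
  define S where "S = (\<lambda>V W e p. \<forall>n::nat. G (from_nat n) V W e p)"
  have S: "game_iterate S" unfolding S_def by (intro game_iterate.inter G)
  moreover have "game_step S V V e p" if "S V V e p" for e p
  proof -
    have "G (from_nat (to_nat (e, p))) V V e p" using that unfolding S_def by blast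
    then show ?thesis using least[of "(e, p)"] game_iterate.step[OF S] by simp
  qed
  ultimately show ?thesis by blast
qed

text \<open>The position is pulled back to \<open>(V, V)\<close>, where stability applies, and the
  result is carried forward again. Each of the two passages uses half of the slack
  \<open>e' - e\<close>.\<close>

lemma almost_isometric_transport:
  assumes S: "game_iterate S" and stable: "\<And>e p. S V V e p \<Longrightarrow> game_step S V V e p"
    and VW: "almost_isometric V W" and "S V W e p" and "e < e'"
  shows "game_step S V W e' p"
proof -
  define d where "d = (e' - e) / 2"
  have d: "d > 0" using \<open>e < e'\<close> by (simp add: d_def)
  obtain R where R: "total_surj R" "distortion_le V W R (of_rat d)"
    using VW d by (auto simp: almost_isometric_def)
  obtain f where f: "\<And>k. (f k, k) \<in> R" using R(1) unfolding total_surj_def by metis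
  define q where "q = map (\<lambda>x. (fst x, f (snd x))) p"
  have "S V V (e + d) q"
    by (rule game_iterate_compose[OF S, of "R\<inverse>" W V d V e p])
      (use R f \<open>S V W e p\<close> in \<open>auto simp: total_surj_converse distortion_le_converse q_def
        list_all2_map2 list.rel_refl\<close>)
  then have "game_step S V V (e + d) q" by (rule stable)
  then have "game_step S V W (e + d + d) p"
    by (rule game_iterate_compose[OF game_iterate.step[OF S] R])
      (use f in \<open>auto simp: q_def list_all2_map1 list.rel_refl\<close>)
  then show ?thesis by (simp add: d_def)
qed

text \<open>The second player survives infinitely many rounds, and the union of the positions is the
  relation sought.\<close>

lemma almost_isometric_of_transport:
  assumes S: "game_iterate S" and empty: "\<And>e. 0 < e \<Longrightarrow> S V W e []"
    and transport: "\<And>e e' p. e < e' \<Longrightarrow> S V W e p \<Longrightarrow> game_step S V W e' p"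
  shows "almost_isometric V W"
  unfolding almost_isometric_def
proof (intro allI impI)
  fix e :: rat assume e: "0 < e"
  \<comment> \<open>Each move raises the tolerance; this strictly increasing sequence starts at
    \<open>e / 2\<close> and keeps all increases together below \<open>e\<close>.\<close>
  define r where "r n = e * (1 - 1 / (of_nat n + 2))" for n :: nat
  have r: "0 < r 0" "r n < r (Suc n)" "r n \<le> e" for n
    using e by (auto simp: r_def field_simps)
  have "\<exists>p. \<forall>n. S V W (r n) (p n) \<and>
     (set (p n) \<subseteq> set (p (Suc n)) \<and> (\<exists>k. (n, k) \<in> set (p (Suc n))) \<and> (\<exists>i. (i, n) \<in> set (p (Suc n))))"
  proof (rule dependent_nat_choice)
    show "\<exists>p. S V W (r 0) p" using empty[OF r(1)] by blast
  next
    fix p n assume "S V W (r n) p"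
    \<comment> \<open>A round has two moves, \<open>n\<close> on the left and \<open>n\<close> on
      the right, hence the intermediate tolerance.\<close>
    obtain s where s: "r n < s" "s < r (Suc n)" using dense[OF r(2)] by blast
    obtain k where k: "S V W s ((n, k) # p)"
      using transport[OF s(1) \<open>S V W (r n) p\<close>] by (auto simp: game_step_def)
    then obtain i where "S V W (r (Suc n)) ((i, n) # (n, k) # p)"
      using transport[OF s(2) k] by (auto simp: game_step_def)
    then show "\<exists>q. S V W (r (Suc n)) q \<and>
        (set p \<subseteq> set q \<and> (\<exists>k. (n, k) \<in> set q) \<and> (\<exists>i. (i, n) \<in> set q))"
      by (rule_tac exI[of _ "(i, n) # (n, k) # p"]) auto
  qed
  then obtain p where p: "\<And>n. S V W (r n) (p n)" "\<And>n. set (p n) \<subseteq> set (p (Suc n))"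
    "\<And>n. \<exists>k. (n, k) \<in> set (p (Suc n))" "\<And>n. \<exists>i. (i, n) \<in> set (p (Suc n))"
    by blast
  have mono: "set (p m) \<subseteq> set (p n)" if "m \<le> n" for m n
    using p(2) that by (rule lift_Suc_mono_le)
  define R where "R = (\<Union>n. set (p n))"
  have small: "distortion_le V W (set (p n)) (of_rat e)" for n
    using game_iterate_le_start[OF S p(1)[of n]] r(3)[of n] unfolding game_start_def
    by (rule distortion_le_mono[OF _ iffD2[OF of_rat_less_eq]])
  have "total_surj R" using p(3,4) unfolding total_surj_def R_def by blast
  moreover have "distortion_le V W R (of_rat e)" unfolding distortion_le_def
  proof (intro ballI)
    fix x y assume "x \<in> R" "y \<in> R"
    then obtain m n where "x \<in> set (p m)" "y \<in> set (p n)" by (auto simp: R_def)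
    then have "x \<in> set (p (max m n))" "y \<in> set (p (max m n))"
      using mono[of m "max m n"] mono[of n "max m n"] by auto
    then show "\<bar>V (fst x, fst y) - W (snd x, snd y)\<bar> \<le> of_rat e"
      using small by (auto simp: distortion_le_def)
  qed
  ultimately show "\<exists>R. total_surj R \<and> distortion_le V W R (of_rat e)" by blast
qed

text \<open>\<open>S\<close> is chosen from \<open>V\<close> alone, so the starting condition and
  the transport condition are countable conjunctions of Borel conditions on
  \<open>W\<close>.\<close>

theorem borel_almost_isometric:
  fixes V :: "nat \<times> nat \<Rightarrow> real"
  shows "{W :: nat \<times> nat \<Rightarrow> real. almost_isometric V W} \<in> sets borel"
proof -
  obtain S where S: "game_iterate S" and stable: "\<And>e p. S V V e p \<Longrightarrow> game_step S V V e p"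
    using game_iterate_stable[of V] by blast
  have "almost_isometric V W \<longleftrightarrow> (\<forall>e. 0 < e \<longrightarrow> S V W e []) \<and>
      (\<forall>e e' p. e < e' \<longrightarrow> S V W e p \<longrightarrow> game_step S V W e' p)" for W
  proof (intro iffI conjI allI impI)
    show "S V W e []" if "almost_isometric V W" "0 < e" for e
      using that game_iterate_of_total_surj[OF S, of _ V W e "[]"]
      by (auto simp: almost_isometric_def)
    show "game_step S V W e' p" if "almost_isometric V W" "e < e'" "S V W e p" for e e' p
      using almost_isometric_transport[OF S stable] that by blast
  qed (use almost_isometric_of_transport[OF S] in blast)
  moreover have "Measurable.pred borel (\<lambda>W. (\<forall>e. 0 < e \<longrightarrow> S V W e []) \<and>
      (\<forall>e e' p. e < e' \<longrightarrow> S V W e p \<longrightarrow> game_step S V W e' p))"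
    by (intro pred_intros_logic(3) pred_intros_imp' pred_intros_logic(4) pred_intros_countable
        borel_game_iterate[OF S] borel_game_iterate[OF game_iterate.step[OF S]])
  ultimately show ?thesis by (simp add: pred_def)
qed

section \<open>Distortion and the Gromov--Hausdorff distance\<close>

text \<open>Infimum of the lengths of paths that cross once, over a bridge of length
  \<open>e\<close> between related points.\<close>

definition glue_dist :: "'a metric \<Rightarrow> 'b metric \<Rightarrow> ('a \<times> 'b) set \<Rightarrow> real \<Rightarrow> 'a \<Rightarrow> 'b \<Rightarrow> real" where
  "glue_dist X Y R e x y = (INF r\<in>R. mdist X x (fst r) + e + mdist Y (snd r) y)"

lemma glue_dist_le:
  assumes "(a, b) \<in> R"
  shows "glue_dist X Y R e x y \<le> mdist X x a + e + mdist Y b y"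
proof -
  have "bdd_below ((\<lambda>r. mdist X x (fst r) + e + mdist Y (snd r) y) ` R)"
    by (intro bdd_belowI2[where m = e]) simp
  from cINF_lower[OF this assms] show ?thesis by (simp add: glue_dist_def)
qed

lemma glue_dist_ge:
  assumes "R \<noteq> {}" "\<And>a b. (a, b) \<in> R \<Longrightarrow> c \<le> mdist X x a + e + mdist Y b y"
  shows "c \<le> glue_dist X Y R e x y"
  unfolding glue_dist_def using assms by (intro cINF_greatest) auto

fun glue_sum_dist :: "'a metric \<Rightarrow> 'b metric \<Rightarrow> ('a \<times> 'b) set \<Rightarrow> real \<Rightarrow> 'a + 'b \<Rightarrow> 'a + 'b \<Rightarrow> real" where
  "glue_sum_dist X Y R e (Inl x) (Inl x') = mdist X x x'"
| "glue_sum_dist X Y R e (Inr y) (Inr y') = mdist Y y y'"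
| "glue_sum_dist X Y R e (Inl x) (Inr y) = glue_dist X Y R e x y"
| "glue_sum_dist X Y R e (Inr y) (Inl x) = glue_dist X Y R e x y"

text \<open>A detour through the other side crosses two bridges and so costs at least
  \<open>2 * e\<close>, which makes up for the distortion. Positivity of \<open>e\<close> keeps
  points of different sides apart.\<close>

lemma Metric_space_glue:
  assumes R: "R \<noteq> {}" "R \<subseteq> mspace X \<times> mspace Y" and e: "e > 0"
    and dist: "distortion_le (case_prod (mdist X)) (case_prod (mdist Y)) R (2 * e)"
  shows "Metric_space (Inl ` mspace X \<union> Inr ` mspace Y) (glue_sum_dist X Y R e)"
proof
  have pos: "e \<le> glue_dist X Y R e x y" for x y by (intro glue_dist_ge R) simp
  show "0 \<le> glue_sum_dist X Y R e u v" for u v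
    using pos e by (cases u; cases v) (auto intro: order_trans[OF less_imp_le])
  show "glue_sum_dist X Y R e u v = glue_sum_dist X Y R e v u" for u v
    by (cases u; cases v) (auto simp: mdist_commute)
  fix u v w
  assume u: "u \<in> Inl ` mspace X \<union> Inr ` mspace Y" and v: "v \<in> Inl ` mspace X \<union> Inr ` mspace Y"
  have "glue_dist X Y R e x y \<noteq> 0" for x y using pos[of x y] e by linarith
  with u v show "glue_sum_dist X Y R e u v = 0 \<longleftrightarrow> u = v"
    by auto
  assume w: "w \<in> Inl ` mspace X \<union> Inr ` mspace Y"
  have XY: "glue_dist X Y R e x y \<le> mdist X x x' + glue_dist X Y R e x' y"
    if "x \<in> mspace X" "x' \<in> mspace X" for x x' y
  proof -
    have "glue_dist X Y R e x y - mdist X x x' \<le> glue_dist X Y R e x' y"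
    proof (intro glue_dist_ge R)
      fix a b assume "(a, b) \<in> R"
      then show "glue_dist X Y R e x y - mdist X x x' \<le> mdist X x' a + e + mdist Y b y"
        using glue_dist_le[of a b R X Y e x y] mdist_triangle[of x X x' a] R that by fastforce
    qed
    then show ?thesis by simp
  qed
  have YX: "glue_dist X Y R e x y \<le> glue_dist X Y R e x y' + mdist Y y' y"
    if "y \<in> mspace Y" "y' \<in> mspace Y" for x y y'
  proof -
    have "glue_dist X Y R e x y - mdist Y y' y \<le> glue_dist X Y R e x y'"
    proof (intro glue_dist_ge R)
      fix a b assume "(a, b) \<in> R"
      then show "glue_dist X Y R e x y - mdist Y y' y \<le> mdist X x a + e + mdist Y b y'"
        using glue_dist_le[of a b R X Y e x y] mdist_triangle[of b Y y' y] R that by fastforce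
    qed
    then show ?thesis by simp
  qed
  have XYX: "mdist X x x' \<le> glue_dist X Y R e x y + glue_dist X Y R e x' y"
    if x: "x \<in> mspace X" "x' \<in> mspace X" "y \<in> mspace Y" for x x' y
  proof -
    have "mdist X x x' - glue_dist X Y R e x' y \<le> glue_dist X Y R e x y"
    proof (intro glue_dist_ge R)
      fix a b assume ab: "(a, b) \<in> R"
      have "mdist X x x' - (mdist X x a + e + mdist Y b y) \<le> glue_dist X Y R e x' y"
      proof (intro glue_dist_ge R)
        fix a' b' assume ab': "(a', b') \<in> R"
        have m: "a \<in> mspace X" "a' \<in> mspace X" "b \<in> mspace Y" "b' \<in> mspace Y"
          using ab ab' R by auto
        show "mdist X x x' - (mdist X x a + e + mdist Y b y) \<le> mdist X x' a' + e + mdist Y b' y"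
          using distortion_leD[OF dist ab ab'] mdist_triangle[OF x(1) m(1) x(2)]
            mdist_triangle[OF m(1,2) x(2)] mdist_triangle[OF m(3) x(3) m(4)]
            mdist_commute[of X x' a'] mdist_commute[of Y y b'] by auto
      qed
      then show "mdist X x x' - glue_dist X Y R e x' y \<le> mdist X x a + e + mdist Y b y" by simp
    qed
    then show ?thesis by simp
  qed
  have YXY: "mdist Y y y' \<le> glue_dist X Y R e x y + glue_dist X Y R e x y'"
    if y: "y \<in> mspace Y" "y' \<in> mspace Y" "x \<in> mspace X" for x y y'
  proof -
    have "mdist Y y y' - glue_dist X Y R e x y' \<le> glue_dist X Y R e x y"
    proof (intro glue_dist_ge R)
      fix a b assume ab: "(a, b) \<in> R"
      have "mdist Y y y' - (mdist X x a + e + mdist Y b y) \<le> glue_dist X Y R e x y'"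
      proof (intro glue_dist_ge R)
        fix a' b' assume ab': "(a', b') \<in> R"
        have m: "a \<in> mspace X" "a' \<in> mspace X" "b \<in> mspace Y" "b' \<in> mspace Y"
          using ab ab' R by auto
        show "mdist Y y y' - (mdist X x a + e + mdist Y b y) \<le> mdist X x a' + e + mdist Y b' y'"
          using distortion_leD[OF dist ab ab'] mdist_triangle[OF y(1) m(3) y(2)]
            mdist_triangle[OF m(3,4) y(2)] mdist_triangle[OF m(1) y(3) m(2)]
            mdist_commute[of X a x] mdist_commute[of Y y b] by auto
      qed
      then show "mdist Y y y' - glue_dist X Y R e x y' \<le> mdist X x a + e + mdist Y b y" by simp
    qed
    then show ?thesis by simp
  qed
  have XY': "glue_dist X Y R e x y \<le> glue_dist X Y R e x' y + mdist X x' x"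
    if "x \<in> mspace X" "x' \<in> mspace X" for x x' y
    using XY[OF that, of y] mdist_commute[of X x' x] by simp
  have YX': "glue_dist X Y R e x y \<le> mdist Y y y' + glue_dist X Y R e x y'"
    if "y \<in> mspace Y" "y' \<in> mspace Y" for x y y'
    using YX[OF that, of x] mdist_commute[of Y y' y] by simp
  show "glue_sum_dist X Y R e u w \<le> glue_sum_dist X Y R e u v + glue_sum_dist X Y R e v w"
    using u v w
    by (elim UnE imageE) (auto intro: mdist_triangle XY XY' YX YX' XYX YXY)
qed

text \<open>Related points are at most \<open>e\<close> apart in the glued space. The slack
  \<open>c\<close> is there because points of a completion are only approximated by indices.\<close>

lemma gromov_hausdorff_dist_le_distortion:
  fixes X :: "'a metric" and Y :: "'b metric"
  assumes R: "R \<noteq> {}" "R \<subseteq> mspace X \<times> mspace Y" and e: "e > 0"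
    and dist: "distortion_le (case_prod (mdist X)) (case_prod (mdist Y)) R (2 * e)"
    and domain: "\<And>x. x \<in> mspace X \<Longrightarrow> \<exists>(a, b)\<in>R. mdist X x a \<le> c"
    and range: "\<And>y. y \<in> mspace Y \<Longrightarrow> \<exists>(a, b)\<in>R. mdist Y b y \<le> c"
  shows "gromov_hausdorff_dist X Y \<le> ennreal (c + e)"
proof -
  define Z where "Z = metric (Inl ` mspace X \<union> Inr ` mspace Y, glue_sum_dist X Y R e)"
  note M = Metric_space_glue[OF R e dist]
  have Z: "mspace Z = Inl ` mspace X \<union> Inr ` mspace Y" "mdist Z = glue_sum_dist X Y R e"
    by (simp_all add: Z_def Metric_space.mspace_metric[OF M] Metric_space.mdist_metric[OF M])
  have "gromov_hausdorff_dist X Y \<le> hausdorff_dist Z (Inl ` mspace X) (Inr ` mspace Y)"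
    by (rule gromov_hausdorff_dist_le) (auto simp: isometric_embedding_def Z)
  also have "\<dots> \<le> ennreal (c + e)" unfolding hausdorff_dist_def
  proof (intro max.boundedI SUP_least)
    fix u assume "u \<in> (Inl ` mspace X :: ('a + 'b) set)"
    then obtain x where x: "u = Inl x" "x \<in> mspace X" by blast
    obtain a b where ab: "(a, b) \<in> R" "mdist X x a \<le> c" using domain[OF x(2)] by blast
    have b: "b \<in> mspace Y" using ab R by blast
    have "glue_dist X Y R e x b \<le> c + e" using glue_dist_le[OF ab(1), of X Y e x b] ab mdist_self[OF b] by simp
    then show "(INF v\<in>Inr ` mspace Y. ennreal (mdist Z u v)) \<le> ennreal (c + e)"
      using b by (intro INF_lower2[of "Inr b"]) (auto simp: Z x intro: ennreal_leI)
  next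
    fix v assume "v \<in> (Inr ` mspace Y :: ('a + 'b) set)"
    then obtain y where y: "v = Inr y" "y \<in> mspace Y" by blast
    obtain a b where ab: "(a, b) \<in> R" "mdist Y b y \<le> c" using range[OF y(2)] by blast
    have a: "a \<in> mspace X" using ab R by blast
    have "glue_dist X Y R e a y \<le> c + e" using glue_dist_le[OF ab(1), of X Y e a y] ab mdist_self[OF a] by simp
    then show "(INF u\<in>Inl ` mspace X. ennreal (mdist Z u v)) \<le> ennreal (c + e)"
      using a by (intro INF_lower2[of "Inl a"]) (auto simp: Z y intro: ennreal_leI)
  qed
  finally show ?thesis .
qed

section \<open>Index points as a dense copy inside the coded space\<close>

definition coded_point :: "(nat \<times> nat \<Rightarrow> real) \<Rightarrow> nat \<Rightarrow> (nat \<Rightarrow> nat set) set" where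
  "coded_point V i = completion_embed (quotient_metric V) (null_rel V `` {i})"

lemma coded_point_mspace: "V \<in> distance_matrices \<Longrightarrow> coded_point V i \<in> mspace (coded_space V)"
  unfolding coded_point_def coded_space_def
  by (intro completion_embed_mspace) (simp add: mspace_quotient_metric quotientI)

lemma mdist_coded_point:
  "V \<in> distance_matrices \<Longrightarrow> mdist (coded_space V) (coded_point V i) (coded_point V k) = V (i, k)"
  unfolding coded_point_def coded_space_def
  by (subst completion_embed_isometric)
    (simp_all add: mspace_quotient_metric quotientI mdist_quotient_metric)

lemma coded_point_dense:
  assumes "V \<in> distance_matrices" "x \<in> mspace (coded_space V)" "e > 0"
  shows "\<exists>i. mdist (coded_space V) (coded_point V i) x \<le> e"
  using completion_embed_dense[of x "quotient_metric V" e] assms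
  by (auto simp: coded_space_def coded_point_def mspace_quotient_metric elim!: quotientE)

lemma gromov_hausdorff_dist_coded_space_le:
  assumes V: "V \<in> distance_matrices" and W: "W \<in> distance_matrices"
    and R: "total_surj R" "distortion_le V W R e" and e: "e > 0"
  shows "gromov_hausdorff_dist (coded_space V) (coded_space W) \<le> ennreal (2 * e)"
proof -
  define R' where "R' = (\<lambda>r. (coded_point V (fst r), coded_point W (snd r))) ` R"
  have "distortion_le (case_prod (mdist (coded_space V))) (case_prod (mdist (coded_space W))) R' e"
    using R(2) by (auto simp: R'_def distortion_le_def mdist_coded_point V W)
  \<comment> \<open>Weakened from \<open>e\<close> to \<open>2 * e\<close>, so that one
    \<open>e\<close> serves both as bridge length and as density scale.\<close>
  then have *: "distortion_le (case_prod (mdist (coded_space V))) (case_prod (mdist (coded_space W))) R' (2 * e)"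
    by (rule distortion_le_mono) (use e in simp)
  have "gromov_hausdorff_dist (coded_space V) (coded_space W) \<le> ennreal (e + e)"
  proof (rule gromov_hausdorff_dist_le_distortion[OF _ _ e *])
    show "R' \<noteq> {}" using R(1) by (auto simp: R'_def total_surj_def)
    show "R' \<subseteq> mspace (coded_space V) \<times> mspace (coded_space W)"
      by (auto simp: R'_def coded_point_mspace V W)
    show "\<exists>(a, b)\<in>R'. mdist (coded_space V) x a \<le> e" if x: "x \<in> mspace (coded_space V)" for x
    proof -
      obtain i where i: "mdist (coded_space V) x (coded_point V i) \<le> e"
        using coded_point_dense[OF V x e] by (auto simp: mdist_commute)
      moreover obtain k where "(i, k) \<in> R" using R(1) by (auto simp: total_surj_def)
      ultimately show ?thesis by (force simp: R'_def)
    qed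
    show "\<exists>(a, b)\<in>R'. mdist (coded_space W) b y \<le> e" if y: "y \<in> mspace (coded_space W)" for y
    proof -
      obtain k where "mdist (coded_space W) (coded_point W k) y \<le> e"
        using coded_point_dense[OF W y e] by auto
      moreover obtain i where "(i, k) \<in> R" using R(1) by (auto simp: total_surj_def)
      ultimately show ?thesis by (force simp: R'_def)
    qed
  qed
  then show ?thesis by simp
qed

text \<open>Strictness turns infima into witnesses: an infimum below \<open>ennreal e\<close> has a
  member below it.\<close>

lemma hausdorff_dist_lessD:
  assumes "hausdorff_dist Z A B < ennreal e"
  shows "x \<in> A \<Longrightarrow> \<exists>y\<in>B. mdist Z x y < e" and "y \<in> B \<Longrightarrow> \<exists>x\<in>A. mdist Z x y < e"
proof -
  have lt: "(SUP a\<in>A. INF b\<in>B. ennreal (mdist Z a b)) < ennreal e"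
    "(SUP b\<in>B. INF a\<in>A. ennreal (mdist Z a b)) < ennreal e"
    using assms by (auto simp: hausdorff_dist_def)
  show "\<exists>y\<in>B. mdist Z x y < e" if "x \<in> A"
    using le_less_trans[OF SUP_upper[OF that] lt(1)] by (auto simp: INF_less_iff ennreal_less_iff)
  show "\<exists>x\<in>A. mdist Z x y < e" if "y \<in> B"
    using le_less_trans[OF SUP_upper[OF that] lt(2)] by (auto simp: INF_less_iff ennreal_less_iff)
qed

text \<open>Indices are related when their points are close in a common space \<open>Z\<close>; the
  quadrilateral inequality turns closeness into distortion of twice the size.\<close>

lemma total_surj_of_gromov_hausdorff_dist_less:
  assumes V: "V \<in> distance_matrices" and W: "W \<in> distance_matrices"
    and less: "gromov_hausdorff_dist (coded_space V) (coded_space W) < ennreal e" and e: "e > 0"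
  shows "\<exists>R. total_surj R \<and> distortion_le V W R (4 * e)"
proof -
  let ?X = "coded_space V" and ?Y = "coded_space W"
  obtain Z :: "((nat \<Rightarrow> nat set) set + (nat \<Rightarrow> nat set) set) metric" and f g
    where f: "isometric_embedding ?X Z f" and g: "isometric_embedding ?Y Z g"
      and h: "hausdorff_dist Z (f ` mspace ?X) (g ` mspace ?Y) < ennreal e"
    using less unfolding gromov_hausdorff_dist_def Inf_less_iff by blast
  define u v where "u i = f (coded_point V i)" and "v k = g (coded_point W k)" for i k
  have u: "u i \<in> mspace Z" "mdist Z (u i) (u i') = V (i, i')" for i i'
    using f V by (auto simp: u_def isometric_embedding_def coded_point_mspace mdist_coded_point)
  have v: "v k \<in> mspace Z" "mdist Z (v k) (v k') = W (k, k')" for k k'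
    using g W by (auto simp: v_def isometric_embedding_def coded_point_mspace mdist_coded_point)
  \<comment> \<open>One \<open>e\<close> bounds the Hausdorff distance, the other pays for
    approximating a point of the completion by an index point.\<close>
  define R where "R = {(i, k). mdist Z (u i) (v k) \<le> 2 * e}"
  have "\<exists>k. (i, k) \<in> R" for i
  proof -
    obtain y where y: "y \<in> mspace ?Y" "mdist Z (u i) (g y) < e"
      using hausdorff_dist_lessD(1)[OF h, of "u i"] V by (auto simp: u_def coded_point_mspace)
    obtain k where "mdist ?Y (coded_point W k) y \<le> e" using coded_point_dense[OF W y(1) e] by blast
    then have "mdist Z (v k) (g y) \<le> e"
      using g W y by (simp add: v_def isometric_embedding_def coded_point_mspace)
    moreover have "g y \<in> mspace Z" using g y by (auto simp: isometric_embedding_def)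
    ultimately have "mdist Z (u i) (v k) \<le> 2 * e"
      using mdist_triangle[OF u(1) _ v(1), of "g y" i k] y(2) mdist_commute[of Z "g y" "v k"] by auto
    then show ?thesis by (auto simp: R_def)
  qed
  moreover have "\<exists>i. (i, k) \<in> R" for k
  proof -
    obtain x where x: "x \<in> mspace ?X" "mdist Z (f x) (v k) < e"
      using hausdorff_dist_lessD(2)[OF h, of "v k"] W by (auto simp: v_def coded_point_mspace)
    obtain i where "mdist ?X (coded_point V i) x \<le> e" using coded_point_dense[OF V x(1) e] by blast
    then have "mdist Z (u i) (f x) \<le> e"
      using f V x by (simp add: u_def isometric_embedding_def coded_point_mspace)
    moreover have "f x \<in> mspace Z" using f x by (auto simp: isometric_embedding_def)
    ultimately have "mdist Z (u i) (v k) \<le> 2 * e"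
      using mdist_triangle[OF u(1) _ v(1), of "f x" i k] x(2) by auto
    then show ?thesis by (auto simp: R_def)
  qed
  ultimately have "total_surj R" by (simp add: total_surj_def)
  moreover have "distortion_le V W R (4 * e)" unfolding distortion_le_def
  proof (intro ballI)
    fix p q assume "p \<in> R" "q \<in> R"
    then show "\<bar>V (fst p, fst q) - W (snd p, snd q)\<bar> \<le> 4 * e"
      using mdist_quad[OF u(1) u(1) v(1) v(1), of "fst p" "fst q" "snd p" "snd q"]
      by (auto simp: R_def u v)
  qed
  ultimately show ?thesis by blast
qed

section \<open>From small distortion to \<open>E_GH\<close> and its classes\<close>

lemma E_GH_iff_almost_isometric:
  assumes V: "V \<in> distance_matrices" and W: "W \<in> distance_matrices"
  shows "(V, W) \<in> E_GH \<longleftrightarrow> almost_isometric V W"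
proof
  assume "(V, W) \<in> E_GH"
  then have 0: "gromov_hausdorff_dist (coded_space V) (coded_space W) = 0" by (simp add: E_GH_def)
  show "almost_isometric V W" unfolding almost_isometric_def
  proof (intro allI impI)
    fix e :: rat assume "0 < e"
    \<comment> \<open>The quarter cancels the factor 4 in the distortion bound.\<close>
    then have "of_rat e / 4 > (0::real)" by simp
    from total_surj_of_gromov_hausdorff_dist_less[OF V W _ this] this
    show "\<exists>R. total_surj R \<and> distortion_le V W R (of_rat e)" by (simp add: 0)
  qed
next
  assume *: "almost_isometric V W"
  let ?d = "gromov_hausdorff_dist (coded_space V) (coded_space W)"
  have small: "?d \<le> 0 + ennreal c" if c: "0 < c" for c
  proof -
    \<comment> \<open>Rational like the tolerances in \<open>almost_isometric\<close>, and below
      \<open>c / 2\<close> because the distance bound is twice the distortion.\<close>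
    obtain e where e: "0 < real_of_rat e" "real_of_rat e < c / 2"
      using of_rat_dense[OF half_gt_zero[OF c]] by blast
    then obtain R where "total_surj R" "distortion_le V W R (of_rat e)"
      using * by (auto simp: almost_isometric_def)
    then have "?d \<le> ennreal (2 * of_rat e)"
      using gromov_hausdorff_dist_coded_space_le[OF V W] e by blast
    also have "\<dots> \<le> ennreal c" using e by (intro ennreal_leI) simp
    finally show ?thesis by simp
  qed
  have "?d \<le> 0" by (rule ennreal_le_epsilon) (rule small)
  then show "(V, W) \<in> E_GH" using V W by (simp add: E_GH_def)
qed

theorem theorem19p10:
  fixes C :: "(nat \<times> nat \<Rightarrow> real) set"
  assumes "C \<in> distance_matrices // E_GH"
  shows "C \<in> sets (restrict_space borel distance_matrices)"
proof -
  obtain V where C: "C = E_GH `` {V}" and V: "V \<in> distance_matrices"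
    using assms by (rule quotientE)
  \<comment> \<open>The set on the right is Borel among all real matrices; the intersection puts
    \<open>C\<close> into the trace sigma-algebra.\<close>
  have "C = distance_matrices \<inter> {W. almost_isometric V W}"
    using V E_GH_iff_almost_isometric[OF V] by (auto simp: C E_GH_def)
  then show ?thesis
    using borel_almost_isometric[of V] by (auto simp: sets_restrict_space)
qed

end
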